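(* Let $n,d\ge 1$ be integers. For $i=1,\dots,n$ let $F_i=g_i-h_i$ with $g_i:\mathbb{R}^d\to\mathbb{R}\cup\{+\infty\}$ lower semicontinuous proper convex and $h_i:\mathbb{R}^d\to\mathbb{R}$ convex. Let $G=\frac1n\sum_{i=1}^n g_i$ (assumed proper), $H=\frac1n\sum_{i=1}^n h_i$ and $F=\frac1n\sum_{i=1}^n F_i=G-H$. Assume that $\alpha^*=\inf_{x\in\mathbb{R}^d}F(x)>-\infty$. Let $\{x^l\}$ be a sequence generated by the SDCA algorithm (described in the context), with $|s_l|=b$ for all $l>0$, where $b\in\{1,\dots,n\}$ is fixed. Then the following statements hold. (a) The sequence $\{F(x^l)\}$ converges almost surely. (b) If $\min_{i}\rho(h_i)>0$, then almost surely $\sum_{l=1}^{\infty}\|x^l-x^{l-1}\|^2<+\infty$ and $\lim_{l\to\infty}\|x^l-x^{l-1}\|=0$. (c) If $\min_{i}\rho(h_i)>0$, then, with probability one, every limit point of $\{x^l\}$ is a critical point of $F$.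
   Context: Norms and inner products are Euclidean. For a convex function $\theta:\mathbb{R}^d\to\mathbb{R}\cup\{+\infty\}$, $\partial\theta(x)$ denotes the usual convex subdifferential, and the modulus of convexity is $\rho(\theta)=\sup\{\rho\ge 0:\ \theta-\frac{\rho}{2}\|\cdot\|^2\text{ is convex on }\mathbb{R}^d\}$. A point $x^*$ is a critical point of $F=G-H$ (with respect to this decomposition) if $\partial G(x^* )\cap\partial H(x^* )\neq\emptyset$. SDCA algorithm (stochastic DCA) for minimizing $F$ over $\mathbb{R}^d$. Initialization: choose a (deterministic) point $x^0\in\mathbb{R}^d$, and set $s_0=\{1,\dots,n\}$. For $l=0,1,2,\dots$ (run indefinitely): 1. For $i\in s_l$ choose $v_i^l\in\partial h_i(x^l)$; for $i\notin s_l$ (which can only occur when $l>0$) set $v_i^l=v_i^{l-1}$. Set $v^l=\frac1n\sum_{i=1}^n v_i^l$. 2. Let $x^{l+1}$ be a solution of the convex problem $\min\{G(x)-\langle v^l,x\rangle:\ x\in\mathbb{R}^d\}$ (a sequence generated by SDCA is one for which such solutions exist and are selected at each iteration). 3. Choose randomly a subset $s_{l+1}\subset\{1,\dots,n\}$ for the next iteration. For $l\ge1$, the random choice means that, conditionally on the entire history of the algorithm before $s_l$ is drawn (all $x^0,\dots,x^l$, $s_0,\dots,s_{l-1}$, and all $v_i^k$ with $k\le l-1$), $s_l$ is uniformly distributed over the subsets of $\{1,\dots,n\}$ of cardinality $b$. All iterates $x^l$ and chosen subgradients $v_i^l$ are random vectors (measurable). "Almost surely" and "with probability one" refer to the randomness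 of the subsets and selections. *)

theory Defs
  imports "HOL-Probability.Probability"
begin

text \<open>
  Functions into \<open>\<real> \<union> {+\<infinity>}\<close> are rendered as functions into \<^typ>\<open>ereal\<close> that never take the
  value \<open>-\<infinity>\<close>; the latter is part of properness below.
\<close>

definition proper_fun :: "('a \<Rightarrow> ereal) \<Rightarrow> bool" where
  "proper_fun \<theta> \<longleftrightarrow> (\<forall>x. \<theta> x \<noteq> -\<infinity>) \<and> (\<exists>x. \<theta> x \<noteq> \<infinity>)"

text \<open>
  Meaningful for functions that avoid \<open>-\<infinity>\<close> (in \<^typ>\<open>ereal\<close>, \<open>\<infinity> + (-\<infinity>) = \<infinity>\<close>).
\<close>

definition convex_fun :: "('a::real_vector \<Rightarrow> ereal) \<Rightarrow> bool" where
  "convex_fun \<theta> \<longleftrightarrow>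
     (\<forall>x y. \<forall>t::real. 0 < t \<and> t < 1 \<longrightarrow>
        \<theta> ((1 - t) *\<^sub>R x + t *\<^sub>R y) \<le> ereal (1 - t) * \<theta> x + ereal t * \<theta> y)"

definition lsc_fun :: "('a::topological_space \<Rightarrow> ereal) \<Rightarrow> bool" where
  "lsc_fun \<theta> \<longleftrightarrow> (\<forall>x. \<theta> x \<le> Liminf (at x) \<theta>)"

definition subdifferential :: "('a::real_inner \<Rightarrow> ereal) \<Rightarrow> 'a \<Rightarrow> 'a set" where
  "subdifferential \<theta> x = {v. \<forall>y. \<theta> x + ereal (v \<bullet> (y - x)) \<le> \<theta> y}"

text \<open>The supremum is taken in \<^typ>\<open>ereal\<close>, since it may be \<open>+\<infinity>\<close> for extended-valued \<open>\<theta>\<close>.\<close>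

definition convexity_modulus :: "('a::real_inner \<Rightarrow> ereal) \<Rightarrow> ereal" where
  "convexity_modulus \<theta> =
     Sup (ereal ` {\<rho>. 0 \<le> \<rho> \<and> convex_fun (\<lambda>x. \<theta> x - ereal (\<rho> / 2 * (norm x)\<^sup>2))})"

text \<open>Criticality refers to the given decomposition \<open>G - H\<close>.\<close>

definition critical_point ::
  "('a::real_inner \<Rightarrow> ereal) \<Rightarrow> ('a \<Rightarrow> real) \<Rightarrow> 'a \<Rightarrow> bool" where
  "critical_point G H x \<longleftrightarrow> subdifferential G x \<inter> subdifferential (\<lambda>y. ereal (H y)) x \<noteq> {}"

text \<open>
  The sigma-algebra of the history before \<open>s\<^sub>l\<close> is drawn: it is generated by
  \<open>x\<^sup>0, \<dots>, x\<^sup>l\<close>, by \<open>s\<^sub>0, \<dots>, s\<^sub>l\<^sub>-\<^sub>1\<close> and by all \<open>v\<^sub>i\<^sup>k\<close> with \<open>k \<le> l - 1\<close>.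
  Here \<open>v k i \<omega>\<close> stands for \<open>v\<^sub>i\<^sup>k\<close>.
\<close>

definition sdca_history ::
  "'w measure \<Rightarrow> nat \<Rightarrow> (nat \<Rightarrow> 'w \<Rightarrow> 'a::topological_space) \<Rightarrow> (nat \<Rightarrow> 'w \<Rightarrow> nat set) \<Rightarrow>
   (nat \<Rightarrow> nat \<Rightarrow> 'w \<Rightarrow> 'a) \<Rightarrow> nat \<Rightarrow> 'w measure" where
  "sdca_history M n x s v l = sigma (space M)
     ({x k -` A \<inter> space M | k A. k \<le> l \<and> A \<in> sets borel} \<union>
      {s k -` A \<inter> space M | k A. k < l} \<union>
      {v k i -` A \<inter> space M | k i A. k < l \<and> i \<in> {1..n} \<and> A \<in> sets borel})"

text \<open>Sequences generated by SDCA: iterates \<open>x\<close>, index sets \<open>s\<close> and subgradients \<open>v\<close>.\<close>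

definition sdca_sequence ::
  "'w measure \<Rightarrow> nat \<Rightarrow> nat \<Rightarrow> ('a::euclidean_space \<Rightarrow> ereal) \<Rightarrow> (nat \<Rightarrow> 'a \<Rightarrow> real) \<Rightarrow>
   (nat \<Rightarrow> 'w \<Rightarrow> 'a) \<Rightarrow> (nat \<Rightarrow> 'w \<Rightarrow> nat set) \<Rightarrow> (nat \<Rightarrow> nat \<Rightarrow> 'w \<Rightarrow> 'a) \<Rightarrow> bool" where
  "sdca_sequence M n b G h x s v \<longleftrightarrow>
     (\<forall>l. x l \<in> borel_measurable M) \<and>
     (\<forall>l. s l \<in> measurable M (count_space (Pow {1..n}))) \<and>
     (\<forall>l. \<forall>i\<in>{1..n}. v l i \<in> borel_measurable M) \<and>
     (\<exists>x0. \<forall>\<omega>\<in>space M. x 0 \<omega> = x0) \<and>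
     (\<forall>\<omega>\<in>space M. s 0 \<omega> = {1..n}) \<and>
     (\<forall>\<omega>\<in>space M. \<forall>l. \<forall>i\<in>s l \<omega>. v l i \<omega> \<in> subdifferential (\<lambda>y. ereal (h i y)) (x l \<omega>)) \<and>
     (\<forall>\<omega>\<in>space M. \<forall>l>0. \<forall>i\<in>{1..n} - s l \<omega>. v l i \<omega> = v (l - 1) i \<omega>) \<and>
     (\<forall>\<omega>\<in>space M. \<forall>l.
        is_arg_min (\<lambda>y. G y - ereal (((1 / real n) *\<^sub>R (\<Sum>i\<in>{1..n}. v l i \<omega>)) \<bullet> y)) (\<lambda>_. True)
          (x (Suc l) \<omega>)) \<and>
     (\<forall>\<omega>\<in>space M. \<forall>l>0. card (s l \<omega>) = b) \<and>
     (\<forall>l>0. \<forall>S. S \<subseteq> {1..n} \<and> card S = b \<longrightarrow>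
        (AE \<omega> in M. real_cond_exp M (sdca_history M n x s v l)
             (indicator {\<omega>\<in>space M. s l \<omega> = S}) \<omega> = 1 / real (n choose b)))"

end

theory Submission
  imports Defs
begin

text \<open>
  At every iterate \<open>x\<^sup>k\<close> at which index \<open>i\<close> is drawn, the chosen subgradient gives an affine
  minorant of \<open>h\<^sub>i\<close>, exact at \<open>x\<^sup>k\<close>; call it a cut. Let \<open>T\<^sub>l\<close> be \<open>G\<close> minus the mean of the
  cuts in force after step \<open>l\<close>. It majorises \<open>F\<close>, and \<open>x\<^sup>l\<^sup>+\<^sup>1\<close> minimises it, because \<open>T\<^sub>l\<close> differs
  from \<open>y \<mapsto> G y - v\<^sup>l \<bullet> y\<close> by a constant. Write \<open>e\<^sub>i\<^sup>l \<ge> 0\<close> for the gap at \<open>x\<^sup>l\<^sup>+\<^sup>1\<close> between \<open>h\<^sub>i\<close> and the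
  cut that is in force just before \<open>s\<^sub>l\<^sub>+\<^sub>1\<close> is drawn. Refreshing the cuts of \<open>s\<^sub>l\<^sub>+\<^sub>1\<close> lowers the model
  at \<open>x\<^sup>l\<^sup>+\<^sup>1\<close> by exactly the mean of the sampled gaps (each index outside the sample counting as 0),
  and minimising lowers it further. So the model values \<open>T\<^sub>l(x\<^sup>l\<^sup>+\<^sup>1)\<close> decrease along \<^emph>\<open>every\<close>
  trajectory, not merely in expectation; they stay above \<open>\<alpha>\<^sup>*\<close>, and the sampled gaps have a sum
  bounded by a constant that does not depend on the trajectory
  (\<open>model_value_Suc\<close>, \<open>sum_sampled_gaps_le\<close>, \<open>model_value_0_le\<close>).

  Randomness enters once. The gap \<open>e\<^sub>i\<^sup>l\<close> is known before \<open>s\<^sub>l\<^sub>+\<^sub>1\<close> is drawn, and a fixed \<open>b\<close>-element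
  set \<open>S\<close> containing \<open>i\<close> is drawn with conditional probability \<open>1 / (n choose b)\<close>. Hence the expected
  gap is \<open>n choose b\<close> times its expectation restricted to the event that \<open>S\<close> is drawn, and
  \<open>\<Sum>\<^sub>l e\<^sub>i\<^sup>l\<close> has finite expectation and is finite almost surely (\<open>summable_of_sampled\<close>).

  On a trajectory with summable gaps the three claims are deterministic. The objective is the
  convergent model value minus a mean gap that tends to 0. If the \<open>h\<^sub>i\<close> are strongly convex, an index
  drawn at step \<open>l\<close> has its cut centred at \<open>x\<^sup>l\<close>, so its gap at \<open>x\<^sup>l\<^sup>+\<^sup>1\<close> dominates a positive multiple of
  \<open>\<parallel>x\<^sup>l\<^sup>+\<^sup>1 - x\<^sup>l\<parallel>\<^sup>2\<close>. Finally \<open>v\<^sup>l\<close> is a subgradient of \<open>G\<close> at \<open>x\<^sup>l\<^sup>+\<^sup>1\<close> and, the mean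
  cut being a minorant of \<open>H\<close>, a subgradient of \<open>H\<close> there up to the mean gap; both properties
  survive the passage to a limit point (\<open>critical_point_limit\<close>).
\<close>

section \<open>Convex functions and subgradients\<close>

text \<open>
  One unit step in the direction of \<open>u\<close> raises the affine minorant by \<open>\<parallel>u\<parallel>\<close>, so an upper bound
  for \<open>H\<close> near \<open>x\<close> limits the length of every approximate subgradient.
\<close>

lemma norm_approx_subgradient_le:
  fixes H :: "'a::real_inner \<Rightarrow> real"
  assumes sub: "\<And>y. H x + u \<bullet> (y - x) \<le> H y + \<epsilon>"
    and bound: "\<And>y. y \<in> cball x 1 \<Longrightarrow> H y \<le> B"
  shows "norm u \<le> B - H x + \<epsilon>"
proof -
  have "u \<bullet> sgn u = norm u"
    by (cases "u = 0") (simp_all add: sgn_div_norm dot_square_norm power2_eq_square)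
  moreover have "H (x + sgn u) \<le> B"
    by (rule bound) (simp add: dist_norm norm_sgn)
  ultimately show ?thesis
    using sub[of "x + sgn u"] by simp
qed

text \<open>
  The limit inferior in \<open>lsc_fun\<close> is over a punctured neighbourhood; a sequence may hit
  its limit, so the value at the limit has to be put
  back.
\<close>

lemma lsc_fun_liminf:
  assumes "lsc_fun \<theta>" "X \<longlonglongrightarrow> a"
  shows "\<theta> a \<le> liminf (\<lambda>k. \<theta> (X k))"
  unfolding le_Liminf_iff
proof (intro allI impI)
  fix c assume c: "c < \<theta> a"
  also have "\<theta> a \<le> Liminf (at a) \<theta>"
    using assms(1) by (simp add: lsc_fun_def)
  finally have "eventually (\<lambda>y. c < \<theta> y) (at a)"
    by (rule less_LiminfD)
  then have "eventually (\<lambda>y. c < \<theta> y) (nhds a)"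
    unfolding eventually_at_filter by (rule eventually_mono) (use c in auto)
  then show "eventually (\<lambda>k. c < \<theta> (X k)) sequentially"
    using assms(2) by (rule eventually_compose_filterlim)
qed

lemma sum_neq_MInfty:
  fixes a :: "'i \<Rightarrow> ereal"
  assumes "\<And>i. i \<in> I \<Longrightarrow> a i \<noteq> -\<infinity>"
  shows "(\<Sum>i\<in>I. a i) \<noteq> -\<infinity>"
  using assms by (induction I rule: infinite_finite_induct) auto

text \<open>
  The values \<open>-\<infinity>\<close> are excluded because superadditivity of the limit inferior can fail when a sum of
  the form \<open>\<infinity> + (-\<infinity>)\<close> arises.
\<close>

lemma liminf_sum_ge:
  fixes g :: "'i \<Rightarrow> nat \<Rightarrow> ereal"
  assumes "finite I" "\<And>i. i \<in> I \<Longrightarrow> a i \<le> liminf (g i)" "\<And>i. i \<in> I \<Longrightarrow> a i \<noteq> -\<infinity>"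
  shows "(\<Sum>i\<in>I. a i) \<le> liminf (\<lambda>k. \<Sum>i\<in>I. g i k)"
  using assms
proof (induction I)
  case empty
  then show ?case by (simp add: Liminf_const)
next
  case (insert j I)
  have IH: "(\<Sum>i\<in>I. a i) \<le> liminf (\<lambda>k. \<Sum>i\<in>I. g i k)"
    using insert by simp
  have fin: "(\<Sum>i\<in>I. a i) \<noteq> -\<infinity>"
    using insert.prems(2) by (intro sum_neq_MInfty) auto
  have j: "a j \<le> liminf (g j)" "a j \<noteq> -\<infinity>"
    using insert.prems by auto
  have "a j + (\<Sum>i\<in>I. a i) \<le> liminf (g j) + liminf (\<lambda>k. \<Sum>i\<in>I. g i k)"
    using j(1) IH by (rule add_mono)
  also have "\<dots> \<le> liminf (\<lambda>k. g j k + (\<Sum>i\<in>I. g i k))"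
    using j IH fin by (intro ereal_liminf_add_mono) auto
  finally show ?case
    using insert.hyps by simp
qed

lemma lsc_mean:
  fixes g :: "nat \<Rightarrow> 'a::topological_space \<Rightarrow> ereal"
  assumes "n \<ge> 1" "\<And>i. i \<in> {1..n} \<Longrightarrow> lsc_fun (g i)" "\<And>i. i \<in> {1..n} \<Longrightarrow> proper_fun (g i)"
    and X: "X \<longlonglongrightarrow> a"
  shows "(\<Sum>i\<in>{1..n}. g i a) / ereal (real n) \<le> liminf (\<lambda>k. (\<Sum>i\<in>{1..n}. g i (X k)) / ereal (real n))"
proof -
  have n: "0 < ereal (real n)" "ereal (real n) \<noteq> \<infinity>"
    using assms(1) by auto
  have "(\<Sum>i\<in>{1..n}. g i a) \<le> liminf (\<lambda>k. \<Sum>i\<in>{1..n}. g i (X k))"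
    using assms by (intro liminf_sum_ge lsc_fun_liminf) (auto simp: proper_fun_def)
  then show ?thesis
    unfolding le_Liminf_iff using n by (simp add: ereal_less_divide_pos)
qed

lemma sum_minus_ereal:
  fixes a :: "'i \<Rightarrow> ereal"
  shows "(\<Sum>i\<in>I. a i - ereal (b i)) = (\<Sum>i\<in>I. a i) - ereal (\<Sum>i\<in>I. b i)"
proof (induction I rule: infinite_finite_induct)
  case (insert j I)
  then show ?case
    by (cases "a j"; cases "\<Sum>i\<in>I. a i") auto
qed auto

lemma subdifferential_if_arg_min:
  assumes "is_arg_min (\<lambda>y. G y - ereal (u \<bullet> y)) (\<lambda>_. True) x"
  shows "u \<in> subdifferential G x"
  unfolding subdifferential_def
proof safe
  fix y
  have "G x - ereal (u \<bullet> x) \<le> G y - ereal (u \<bullet> y)"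
    using assms by (auto simp: is_arg_min_def not_less)
  then show "G x + ereal (u \<bullet> (y - x)) \<le> G y"
    by (cases "G x"; cases "G y") (auto simp: inner_diff_right)
qed

text \<open>
  Compare the strong convexity inequality on the segment from \<open>x\<close> to \<open>y\<close> with the subgradient
  inequality at a point of the segment at relative distance \<open>t\<close> from \<open>x\<close>, divide by \<open>t\<close> and let
  \<open>t\<close> tend to 0. Below \<open>z = 1 - t\<close>.
\<close>

lemma strong_subgradient:
  fixes f :: "'a::real_inner \<Rightarrow> real"
  assumes conv: "convex_fun (\<lambda>x. ereal (f x) - ereal (\<rho> / 2 * (norm x)\<^sup>2))"
    and u: "u \<in> subdifferential (\<lambda>y. ereal (f y)) x"
  shows "f x + u \<bullet> (y - x) + \<rho> / 2 * (norm (y - x))\<^sup>2 \<le> f y"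
proof -
  have "z * (\<rho> / 2 * (norm (y - x))\<^sup>2) \<le> f y - f x - u \<bullet> (y - x)"
    if z: "0 < z" "z < 1" for z
  proof -
    define t where "t = 1 - z"
    have t: "0 < t" "t < 1" using z by (auto simp: t_def)
    define w where "w = (1 - t) *\<^sub>R x + t *\<^sub>R y"
    have "ereal (f w) - ereal (\<rho> / 2 * (norm w)\<^sup>2) \<le>
        ereal (1 - t) * (ereal (f x) - ereal (\<rho> / 2 * (norm x)\<^sup>2))
        + ereal t * (ereal (f y) - ereal (\<rho> / 2 * (norm y)\<^sup>2))"
      using conv t unfolding convex_fun_def w_def by blast
    then have 1: "f w - \<rho> / 2 * (norm w)\<^sup>2 \<le>
        (1 - t) * (f x - \<rho> / 2 * (norm x)\<^sup>2) + t * (f y - \<rho> / 2 * (norm y)\<^sup>2)"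
      by simp
    have 2: "(1 - t) * (norm x)\<^sup>2 + t * (norm y)\<^sup>2 - (norm w)\<^sup>2 = t * (1 - t) * (norm (y - x))\<^sup>2"
      unfolding w_def by (simp add: power2_norm_eq_inner inner_simps inner_commute algebra_simps)
    have "w - x = t *\<^sub>R (y - x)"
      by (simp add: w_def algebra_simps)
    moreover have "f x + u \<bullet> (w - x) \<le> f w"
      using u by (auto simp: subdifferential_def)
    ultimately have "f x + t * (u \<bullet> (y - x)) \<le> f w"
      by simp
    also have "f w \<le> (1 - t) * f x + t * f y
        - \<rho> / 2 * ((1 - t) * (norm x)\<^sup>2 + t * (norm y)\<^sup>2 - (norm w)\<^sup>2)"
      using 1 by (simp add: algebra_simps diff_divide_distrib add_divide_distrib)
    finally have "t * ((1 - t) * (\<rho> / 2 * (norm (y - x))\<^sup>2)) \<le> t * (f y - f x - u \<bullet> (y - x))"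
      unfolding 2 by (simp add: algebra_simps diff_divide_distrib add_divide_distrib)
    then show ?thesis
      using t by (simp add: t_def)
  qed
  then have "\<rho> / 2 * (norm (y - x))\<^sup>2 \<le> f y - f x - u \<bullet> (y - x)"
    by (rule field_le_mult_one_interval)
  then show ?thesis by simp
qed

text \<open>
  The moduli are suprema that need not be attained and may be infinite, so a real constant below
  all of them is extracted.
\<close>

lemma uniform_modulus:
  assumes fin: "finite I" "I \<noteq> {}"
    and pos: "Min ((\<lambda>i. convexity_modulus (\<theta> i)) ` I) > 0"
  shows "\<exists>\<rho>>0. \<forall>i\<in>I. \<exists>r\<ge>\<rho>. convex_fun (\<lambda>y. \<theta> i y - ereal (r / 2 * (norm y)\<^sup>2))"
proof -
  have "\<exists>r>0. convex_fun (\<lambda>y. \<theta> i y - ereal (r / 2 * (norm y)\<^sup>2))" if "i \<in> I" for i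
  proof -
    have "0 < convexity_modulus (\<theta> i)"
      using pos that fin by simp
    then show ?thesis
      unfolding convexity_modulus_def less_Sup_iff by auto
  qed
  then obtain r where r: "\<And>i. i \<in> I \<Longrightarrow> r i > 0"
    "\<And>i. i \<in> I \<Longrightarrow> convex_fun (\<lambda>y. \<theta> i y - ereal (r i / 2 * (norm y)\<^sup>2))"
    by metis
  show ?thesis
  proof (rule exI[of _ "Min (r ` I)"], intro conjI ballI)
    show "Min (r ` I) > 0"
      using fin r(1) by simp
    show "\<exists>t\<ge>Min (r ` I). convex_fun (\<lambda>y. \<theta> i y - ereal (t / 2 * (norm y)\<^sup>2))" if "i \<in> I" for i
      using fin r(2)[OF that] that by (intro exI[of _ "r i"]) simp
  qed
qed

text \<open>
  The approximate subgradients of \<open>H\<close> are bounded because \<open>H\<close> is bounded near the bounded sequence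
  \<open>X\<close>; a cluster point of them belongs to both subdifferentials, by continuity of \<open>H\<close> and lower
  semicontinuity of \<open>G\<close>.
\<close>

lemma critical_point_limit:
  fixes G :: "'a::euclidean_space \<Rightarrow> ereal"
  assumes cont: "continuous_on UNIV H"
    and G: "G a \<le> liminf (\<lambda>k. G (X k))" "G a \<noteq> -\<infinity>"
    and X: "X \<longlonglongrightarrow> a"
    and \<epsilon>: "\<epsilon> \<longlonglongrightarrow> 0"
    and uH: "\<And>k y. H (X k) + u k \<bullet> (y - X k) \<le> H y + \<epsilon> k"
    and uG: "\<And>k. u k \<in> subdifferential G (X k)"
  shows "critical_point G H a"
proof -
  have "Bseq X" "Bseq \<epsilon>"
    using X \<epsilon> by (auto intro: convergent_imp_Bseq convergentI)
  then obtain R E where R: "\<And>k. norm (X k) \<le> R" and E: "\<And>k. \<bar>\<epsilon> k\<bar> \<le> E"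
    unfolding Bseq_def by auto
  have "compact (H ` cball 0 (R + 1))"
    by (intro compact_continuous_image continuous_on_subset[OF cont]) auto
  then obtain B where "\<forall>z\<in>H ` cball 0 (R + 1). norm z \<le> B"
    using compact_imp_bounded bounded_iff by metis
  then have B: "\<bar>H y\<bar> \<le> B" if "norm y \<le> R + 1" for y
    using that by auto
  have "norm (u k) \<le> 2 * B + E" for k
  proof -
    have "norm (u k) \<le> B - H (X k) + \<epsilon> k"
    proof (rule norm_approx_subgradient_le[OF uH])
      fix y assume "y \<in> cball (X k) 1"
      then have "norm y \<le> R + 1"
        using R[of k] norm_triangle_ineq2[of y "X k"] by (simp add: dist_norm norm_minus_commute)
      then show "H y \<le> B" using B by force
    qed
    then show ?thesis
      using B[of "X k"] R[of k] E[of k] by linarith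
  qed
  then have "\<forall>k. u k \<in> cball 0 (2 * B + E)"
    by simp
  then obtain w q where q: "strict_mono (q :: nat \<Rightarrow> nat)" and w: "(u \<circ> q) \<longlonglongrightarrow> w"
    using compact_cball[of 0 "2 * B + E"] unfolding compact_def by meson
  have w: "(\<lambda>k. u (q k)) \<longlonglongrightarrow> w"
    using w by (simp add: o_def)
  have Xq: "(\<lambda>k. X (q k)) \<longlonglongrightarrow> a" and \<epsilon>q: "(\<lambda>k. \<epsilon> (q k)) \<longlonglongrightarrow> 0"
    using LIMSEQ_subseq_LIMSEQ[OF X q] LIMSEQ_subseq_LIMSEQ[OF \<epsilon> q] by (simp_all add: o_def)
  have "w \<in> subdifferential (\<lambda>y. ereal (H y)) a"
    unfolding subdifferential_def
  proof (safe, simp)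
    fix y
    have H: "(\<lambda>k. H (X (q k))) \<longlonglongrightarrow> H a"
      using continuous_on_tendsto_compose[OF cont Xq] by simp
    have "(\<lambda>k. H (X (q k)) + u (q k) \<bullet> (y - X (q k))) \<longlonglongrightarrow> H a + w \<bullet> (y - a)"
      by (intro tendsto_intros H w Xq)
    moreover have "(\<lambda>k. H y + \<epsilon> (q k)) \<longlonglongrightarrow> H y + 0"
      by (intro tendsto_intros \<epsilon>q)
    ultimately show "H a + w \<bullet> (y - a) \<le> H y"
      using uH by (auto intro!: LIMSEQ_le)
  qed
  moreover have "w \<in> subdifferential G a"
    unfolding subdifferential_def
  proof safe
    fix y
    have step: "G (X (q k)) \<le> G y - ereal (u (q k) \<bullet> (y - X (q k)))" for k
      using uG[of "q k"] by (simp add: subdifferential_def ereal_le_minus)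
    have "(\<lambda>k. u (q k) \<bullet> (y - X (q k))) \<longlonglongrightarrow> w \<bullet> (y - a)"
      by (intro tendsto_intros w Xq)
    then have lim: "(\<lambda>k. G y - ereal (u (q k) \<bullet> (y - X (q k)))) \<longlonglongrightarrow> G y - ereal (w \<bullet> (y - a))"
      by (cases "G y") (auto intro!: tendsto_diff)
    have "G a \<le> liminf (\<lambda>k. G (X (q k)))"
      using G(1) liminf_subseq_mono[OF q, of "\<lambda>k. G (X k)"] by (simp add: o_def)
    also have "\<dots> \<le> liminf (\<lambda>k. G y - ereal (u (q k) \<bullet> (y - X (q k))))"
      by (intro Liminf_mono always_eventually allI step)
    also have "\<dots> = G y - ereal (w \<bullet> (y - a))"
      using lim by (intro lim_imp_Liminf) auto
    finally show "G a + ereal (w \<bullet> (y - a)) \<le> G y"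
      by (simp add: ereal_le_minus)
  qed
  ultimately show ?thesis
    unfolding critical_point_def by blast
qed

section \<open>Summability from sampled partial sums\<close>

text \<open>
  The term \<open>e l\<close> is known to \<open>F l\<close> while \<open>B l\<close> has the constant conditional probability \<open>c\<close>, so
  \<open>c \<cdot> E[e l] = E[e l; B l]\<close>. A pathwise bound on the sampled sums thus becomes a bound on the
  expectation of the whole series. Integrability of \<open>e l\<close> is a conclusion: only its restriction to
  \<open>B l\<close> is known to be bounded.
\<close>

lemma summable_of_sampled:
  fixes e :: "nat \<Rightarrow> 'w \<Rightarrow> real"
  assumes "prob_space M"
    and sub: "\<And>l. subalgebra M (F l)"
    and B: "\<And>l. B l \<in> sets M"
    and cond: "\<And>l. AE \<omega> in M. real_cond_exp M (F l) (indicator (B l)) \<omega> = c" "c > 0"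
    and e: "\<And>l. e l \<in> borel_measurable (F l)" "\<And>l \<omega>. \<omega> \<in> space M \<Longrightarrow> 0 \<le> e l \<omega>"
    and bound: "\<And>\<omega> N. \<omega> \<in> space M \<Longrightarrow> (\<Sum>l<N. e l \<omega> * indicator (B l) \<omega>) \<le> C"
  shows "AE \<omega> in M. summable (\<lambda>l. e l \<omega>)"
proof -
  interpret prob_space M by fact
  have eM[measurable]: "e l \<in> borel_measurable M" for l
    using measurable_from_subalg[OF sub e(1)] .
  note B[measurable]
  have int: "integrable M (\<lambda>\<omega>. e l \<omega> * indicator (B l) \<omega>)" for l
  proof (rule integrable_const_bound[of _ C])
    show "AE \<omega> in M. norm (e l \<omega> * indicator (B l) \<omega>) \<le> C"
    proof (rule AE_I2)
      fix \<omega> assume \<omega>: "\<omega> \<in> space M"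
      have "e l \<omega> * indicator (B l) \<omega> \<le> (\<Sum>k<Suc l. e k \<omega> * indicator (B k) \<omega>)"
        using e(2)[OF \<omega>] by (simp add: sum_nonneg)
      also have "\<dots> \<le> C" by (rule bound[OF \<omega>])
      finally show "norm (e l \<omega> * indicator (B l) \<omega>) \<le> C"
        using e(2)[OF \<omega>] by (simp add: abs_mult)
    qed
  qed simp
  have expect: "integrable M (e l)" "c * (\<integral>\<omega>. e l \<omega> \<partial>M) = (\<integral>\<omega>. e l \<omega> * indicator (B l) \<omega> \<partial>M)" for l
  proof -
    interpret finite_measure_subalgebra M "F l"
      by unfold_locales (rule sub)
    have ae: "AE \<omega> in M. e l \<omega> * real_cond_exp M (F l) (indicator (B l)) \<omega> = e l \<omega> * c"
      using cond(1)[of l] by eventually_elim simp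
    note cm[measurable] = borel_measurable_cond_exp2[of M "F l" "indicator (B l)"]
    have "integrable M (\<lambda>\<omega>. e l \<omega> * c)"
      using integrable_cong_AE[OF _ _ ae] real_cond_exp_intg(1)[OF int e(1)] by simp
    then show "integrable M (e l)"
      using cond(2) by simp
    have "(\<integral>\<omega>. e l \<omega> * c \<partial>M) = (\<integral>\<omega>. e l \<omega> * indicator (B l) \<omega> \<partial>M)"
      using integral_cong_AE[OF _ _ ae] real_cond_exp_intg(2)[OF int e(1)] by simp
    then show "c * (\<integral>\<omega>. e l \<omega> \<partial>M) = (\<integral>\<omega>. e l \<omega> * indicator (B l) \<omega> \<partial>M)"
      by (simp add: mult.commute)
  qed
  have nn: "(\<integral>\<^sup>+\<omega>. ennreal (e l \<omega>) \<partial>M) = ennreal (\<integral>\<omega>. e l \<omega> \<partial>M)" for l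
    by (rule nn_integral_eq_integral[OF expect(1)]) (simp add: e(2))
  have partial: "(\<Sum>l<N. \<integral>\<omega>. e l \<omega> \<partial>M) \<le> C / c" for N
  proof -
    have "c * (\<Sum>l<N. \<integral>\<omega>. e l \<omega> \<partial>M) = (\<integral>\<omega>. (\<Sum>l<N. e l \<omega> * indicator (B l) \<omega>) \<partial>M)"
      by (simp only: sum_distrib_left expect(2) Bochner_Integration.integral_sum[OF int])
    also have "\<dots> \<le> (\<integral>\<omega>. C \<partial>M)"
      by (intro integral_mono Bochner_Integration.integrable_sum int bound) simp_all
    finally show ?thesis
      using cond(2) by (simp add: prob_space field_simps)
  qed
  have "(\<integral>\<^sup>+\<omega>. (\<Sum>l. ennreal (e l \<omega>)) \<partial>M) = (\<Sum>l. ennreal (\<integral>\<omega>. e l \<omega> \<partial>M))"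
    by (simp add: nn_integral_suminf nn)
  also have "\<dots> \<le> ennreal (C / c)"
  proof (rule suminf_le_const)
    fix N
    show "(\<Sum>l<N. ennreal (\<integral>\<omega>. e l \<omega> \<partial>M)) \<le> ennreal (C / c)"
      using partial[of N] by (subst sum_ennreal) (auto intro!: ennreal_leI integral_nonneg_AE simp: e(2))
  qed simp
  finally have "(\<integral>\<^sup>+\<omega>. (\<Sum>l. ennreal (e l \<omega>)) \<partial>M) \<noteq> \<infinity>"
    by (auto simp: top_unique)
  then have "AE \<omega> in M. (\<Sum>l. ennreal (e l \<omega>)) \<noteq> \<infinity>"
    by (intro nn_integral_PInf_AE) auto
  then show ?thesis
    using AE_space by eventually_elim (auto intro!: summable_suminf_not_top e(2))
qed
section \<open>Cuts of a convex function along a trajectory\<close>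

text \<open>
  The cut after step \<open>l\<close> is \<open>y \<mapsto> cut_offset l + u l \<bullet> y\<close>: the subgradient inequality recorded at
  the last time at which \<open>fresh\<close> held. Recursion on the constant term avoids naming that time,
  which keeps measurability of the cut an easy induction.
\<close>

primrec cut_offset ::
  "('a::real_inner \<Rightarrow> real) \<Rightarrow> (nat \<Rightarrow> 'a) \<Rightarrow> (nat \<Rightarrow> bool) \<Rightarrow> (nat \<Rightarrow> 'a) \<Rightarrow> nat \<Rightarrow> real" where
  "cut_offset f x fresh u 0 = f (x 0) - u 0 \<bullet> x 0"
| "cut_offset f x fresh u (Suc l) =
     (if fresh (Suc l) then f (x (Suc l)) - u (Suc l) \<bullet> x (Suc l) else cut_offset f x fresh u l)"

text \<open>
  The cut of step \<open>l\<close> is tested at the \<^emph>\<open>next\<close> iterate, where it is in force before the next update.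
\<close>

definition cut_gap ::
  "('a::real_inner \<Rightarrow> real) \<Rightarrow> (nat \<Rightarrow> 'a) \<Rightarrow> (nat \<Rightarrow> bool) \<Rightarrow> (nat \<Rightarrow> 'a) \<Rightarrow> nat \<Rightarrow> real" where
  "cut_gap f x fresh u l = f (x (Suc l)) - (cut_offset f x fresh u l + u l \<bullet> x (Suc l))"

lemma cut_le:
  assumes "fresh 0"
    and "\<And>l. fresh l \<Longrightarrow> u l \<in> subdifferential (\<lambda>y. ereal (f y)) (x l)"
    and "\<And>l. \<not> fresh (Suc l) \<Longrightarrow> u (Suc l) = u l"
  shows "cut_offset f x fresh u l + u l \<bullet> y \<le> f y"
proof (induction l)
  case 0
  show ?case
    using assms(2)[OF assms(1)] by (auto simp: subdifferential_def inner_diff_right algebra_simps)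
next
  case (Suc l)
  then show ?case
    using assms(2)[of "Suc l"] assms(3)[of l]
    by (auto simp: subdifferential_def inner_diff_right algebra_simps)
qed

lemma cut_offset_fresh:
  assumes "fresh l"
  shows "cut_offset f x fresh u l = f (x l) - u l \<bullet> x l"
  using assms by (cases l) auto

lemma cut_gap_ge_dist:
  assumes "convex_fun (\<lambda>x. ereal (f x) - ereal (\<rho> / 2 * (norm x)\<^sup>2))"
    and "fresh l" "u l \<in> subdifferential (\<lambda>y. ereal (f y)) (x l)"
  shows "\<rho> / 2 * (norm (x (Suc l) - x l))\<^sup>2 \<le> cut_gap f x fresh u l"
  using strong_subgradient[OF assms(1,3), of "x (Suc l)"] cut_offset_fresh[of fresh l f x u, OF assms(2)] by (simp add: cut_gap_def inner_diff_right)

section \<open>A single trajectory of SDCA\<close>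

text \<open>
  One realisation of the algorithm, without probability. Optimality of \<open>x (Suc l)\<close> is expressed by
  the subgradient inequality for \<open>G\<close>, which is how it is used, and \<open>lower_bound\<close> says
  \<open>G - H \<ge> \<alpha>\<close> in a form free of differences of infinite values.
\<close>

locale sdca_path =
  fixes n :: nat
    and h :: "nat \<Rightarrow> 'a::euclidean_space \<Rightarrow> real"
    and G :: "'a \<Rightarrow> ereal"
    and \<alpha> :: real
    and x :: "nat \<Rightarrow> 'a"
    and s :: "nat \<Rightarrow> nat set"
    and v :: "nat \<Rightarrow> nat \<Rightarrow> 'a"
  assumes n_pos: "n \<ge> 1"
    and proper: "proper_fun G"
    and lower_bound: "\<And>y. ereal (\<alpha> + (\<Sum>i\<in>{1..n}. h i y) / real n) \<le> G y"
    and s_zero: "s 0 = {1..n}"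
    and s_subset: "\<And>l. s l \<subseteq> {1..n}"
    and s_nonempty: "\<And>l. s l \<noteq> {}"
    and fresh: "\<And>l i. i \<in> s l \<Longrightarrow> v l i \<in> subdifferential (\<lambda>y. ereal (h i y)) (x l)"
    and stale: "\<And>l i. i \<in> {1..n} - s (Suc l) \<Longrightarrow> v (Suc l) i = v l i"
    and optimal: "\<And>l. (1 / real n) *\<^sub>R (\<Sum>i\<in>{1..n}. v l i) \<in> subdifferential G (x (Suc l))"
begin

definition H :: "'a \<Rightarrow> real" where
  "H y = (\<Sum>i\<in>{1..n}. h i y) / real n"

definition gap :: "nat \<Rightarrow> nat \<Rightarrow> real" where
  "gap i = cut_gap (h i) x (\<lambda>l. i \<in> s l) (\<lambda>l. v l i)"

definition offset :: "nat \<Rightarrow> nat \<Rightarrow> real" where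
  "offset i = cut_offset (h i) x (\<lambda>l. i \<in> s l) (\<lambda>l. v l i)"

definition mean_v :: "nat \<Rightarrow> 'a" where
  "mean_v l = (1 / real n) *\<^sub>R (\<Sum>i\<in>{1..n}. v l i)"

definition mean_gap :: "nat \<Rightarrow> real" where
  "mean_gap l = (\<Sum>i\<in>{1..n}. gap i l) / real n"

definition mean_offset :: "nat \<Rightarrow> real" where
  "mean_offset l = (\<Sum>i\<in>{1..n}. offset i l) / real n"

text \<open>
  The minimal value of the convex model \<open>y \<mapsto> G y - (mean_offset l + mean_v l \<bullet> y)\<close>, attained at
  \<open>x (Suc l)\<close>.
\<close>

definition model_value :: "nat \<Rightarrow> real" where
  "model_value l = real_of_ereal (G (x (Suc l))) - mean_offset l - mean_v l \<bullet> x (Suc l)"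

text \<open>
  Only the initial point can lie outside the domain of \<open>G\<close>: a later iterate is a minimiser, and the
  model is finite wherever \<open>G\<close> is.
\<close>

lemma G_finite: "G (x (Suc l)) = ereal (real_of_ereal (G (x (Suc l))))"
proof -
  obtain y where y: "G y \<noteq> \<infinity>" "G y \<noteq> -\<infinity>"
    using proper unfolding proper_fun_def by auto
  have "G (x (Suc l)) + ereal (mean_v l \<bullet> (y - x (Suc l))) \<le> G y"
    using optimal by (simp add: subdifferential_def mean_v_def)
  then have "G (x (Suc l)) \<noteq> \<infinity>"
    using y by auto
  then show ?thesis
    using proper by (cases "G (x (Suc l))") (auto simp: proper_fun_def)
qed

lemma cut_le_h:
  assumes "i \<in> {1..n}"
  shows "offset i l + v l i \<bullet> y \<le> h i y"
  unfolding offset_def using assms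
  by (intro cut_le) (auto simp: s_zero fresh stale)

lemma gap_nonneg: "i \<in> {1..n} \<Longrightarrow> 0 \<le> gap i l"
  using cut_le_h[of i l "x (Suc l)"] by (simp add: gap_def cut_gap_def offset_def)

lemma mean_gap_eq: "H (x (Suc l)) = mean_offset l + mean_v l \<bullet> x (Suc l) + mean_gap l"
proof -
  have "h i (x (Suc l)) = offset i l + v l i \<bullet> x (Suc l) + gap i l" for i
    by (simp add: gap_def cut_gap_def offset_def)
  then show ?thesis
    by (simp add: H_def mean_offset_def mean_v_def mean_gap_def sum.distrib inner_sum_left
        add_divide_distrib)
qed

lemma mean_cut_le: "mean_offset l + mean_v l \<bullet> y \<le> H y"
proof -
  have "(\<Sum>i\<in>{1..n}. offset i l + v l i \<bullet> y) \<le> (\<Sum>i\<in>{1..n}. h i y)"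
    by (intro sum_mono cut_le_h)
  then have "(\<Sum>i\<in>{1..n}. offset i l + v l i \<bullet> y) / real n \<le> H y"
    by (simp add: H_def divide_right_mono)
  then show ?thesis
    by (simp add: mean_offset_def mean_v_def sum.distrib inner_sum_left add_divide_distrib)
qed

lemma mean_v_approx_subgradient:
  "H (x (Suc l)) + mean_v l \<bullet> (y - x (Suc l)) \<le> H y + mean_gap l"
  using mean_cut_le[of l y] by (simp add: mean_gap_eq inner_diff_right)

lemma model_value_eq:
  "model_value l = real_of_ereal (G (x (Suc l))) - H (x (Suc l)) + mean_gap l"
  by (simp add: model_value_def mean_gap_eq)

lemma mean_gap_nonneg: "0 \<le> mean_gap l"
  by (auto simp: mean_gap_def intro!: divide_nonneg_nonneg sum_nonneg gap_nonneg)

lemma model_value_ge: "\<alpha> \<le> model_value l"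
proof -
  have "ereal (\<alpha> + H (x (Suc l))) \<le> ereal (real_of_ereal (G (x (Suc l))))"
    using lower_bound[of "x (Suc l)"] unfolding G_finite[symmetric] H_def .
  then show ?thesis
    using mean_gap_nonneg[of l] by (simp add: model_value_eq)
qed

lemma model_value_optimal:
  assumes "G y = ereal r"
  shows "model_value l \<le> r - mean_offset l - mean_v l \<bullet> y"
proof -
  have "G (x (Suc l)) + ereal (mean_v l \<bullet> (y - x (Suc l))) \<le> G y"
    using optimal by (simp add: subdifferential_def mean_v_def)
  then have "real_of_ereal (G (x (Suc l))) + mean_v l \<bullet> (y - x (Suc l)) \<le> r"
    unfolding assms by (subst (asm) G_finite) simp
  then show ?thesis
    by (simp add: model_value_def inner_diff_right)
qed

text \<open>
  The descent that drives the proof. At the point \<open>x (Suc l)\<close> the new cuts exceed the old ones by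
  the gap for the indices just drawn and coincide with them otherwise; the next iterate then
  minimises the new model, whose value at \<open>x (Suc l)\<close> is an upper bound for the minimum.
\<close>

lemma model_value_Suc:
  "model_value (Suc l) + (\<Sum>i\<in>s (Suc l). gap i l) / real n \<le> model_value l"
proof -
  let ?z = "x (Suc l)"
  have split: "offset i (Suc l) + v (Suc l) i \<bullet> ?z
      = offset i l + v l i \<bullet> ?z + (if i \<in> s (Suc l) then gap i l else 0)" if "i \<in> {1..n}" for i
    using stale[of i l] that by (auto simp: offset_def gap_def cut_gap_def)
  have "(\<Sum>i\<in>{1..n}. offset i (Suc l) + v (Suc l) i \<bullet> ?z)
      = (\<Sum>i\<in>{1..n}. offset i l + v l i \<bullet> ?z) + (\<Sum>i\<in>{1..n}. if i \<in> s (Suc l) then gap i l else 0)"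
    by (simp only: sum.distrib[symmetric] split cong: sum.cong)
  also have "(\<Sum>i\<in>{1..n}. if i \<in> s (Suc l) then gap i l else 0) = (\<Sum>i\<in>s (Suc l). gap i l)"
    using s_subset[of "Suc l"] by (simp add: sum.If_cases Int_absorb1)
  finally have "mean_offset (Suc l) + mean_v (Suc l) \<bullet> ?z
      = mean_offset l + mean_v l \<bullet> ?z + (\<Sum>i\<in>s (Suc l). gap i l) / real n"
    by (simp add: mean_offset_def mean_v_def sum.distrib inner_sum_left add_divide_distrib [symmetric])
  then show ?thesis
    using model_value_optimal[OF G_finite, of "Suc l" l] by (simp add: model_value_def)
qed

lemma sum_sampled_gaps_le:
  "(\<Sum>l<N. (\<Sum>i\<in>s (Suc l). gap i l) / real n) \<le> model_value 0 - \<alpha>"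
proof -
  have "(\<Sum>l<N. (\<Sum>i\<in>s (Suc l). gap i l) / real n) \<le> (\<Sum>l<N. model_value l - model_value (Suc l))"
    using model_value_Suc by (intro sum_mono) (simp add: algebra_simps)
  also have "\<dots> = model_value 0 - model_value N"
    by (rule sum_lessThan_telescope')
  finally show ?thesis
    using model_value_ge[of N] by linarith
qed

text \<open>
  The right-hand side involves the trajectory only through \<open>x 0\<close>. For a deterministic initial point
  the budget of sampled gaps is therefore a constant, whichever subgradients are selected there.
\<close>

lemma model_value_0_le:
  assumes "G y = ereal r" and B: "\<And>z. z \<in> cball (x 0) 1 \<Longrightarrow> H z \<le> B"
  shows "model_value 0 \<le> r - H (x 0) + (B - H (x 0)) * norm (x 0 - y)"
proof -
  have "offset i 0 = h i (x 0) - v 0 i \<bullet> x 0" for i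
    by (simp add: offset_def)
  then have off: "mean_offset 0 = H (x 0) - mean_v 0 \<bullet> x 0"
    by (simp add: mean_offset_def H_def mean_v_def sum_subtractf inner_sum_left diff_divide_distrib)
  have "norm (mean_v 0) \<le> B - H (x 0) + 0"
    using mean_cut_le[of 0] off
    by (intro norm_approx_subgradient_le B) (simp_all add: inner_diff_right algebra_simps)
  then have "mean_v 0 \<bullet> (x 0 - y) \<le> (B - H (x 0)) * norm (x 0 - y)"
    by (intro order_trans[OF norm_cauchy_schwarz] mult_right_mono) auto
  then show ?thesis
    using model_value_optimal[OF assms(1), of 0] off by (simp add: inner_diff_right)
qed

text \<open>
  A single gap, counted only when the whole set \<open>S\<close> is drawn, is one of the sampled gaps. Testing
  for \<open>S\<close> rather than for membership of \<open>i\<close> gives an event whose conditional probability is known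
  directly.
\<close>

lemma sum_gap_le:
  assumes i: "i \<in> {1..n}" and S: "i \<in> S"
  shows "(\<Sum>l<N. gap i l * indicator {l. s (Suc l) = S} l) \<le> real n * (model_value 0 - \<alpha>)"
proof -
  have "gap i l * indicator {l. s (Suc l) = S} l \<le> (\<Sum>i\<in>s (Suc l). gap i l)" for l
  proof (cases "s (Suc l) = S")
    case True
    have "gap i l \<le> (\<Sum>i\<in>S. gap i l)"
      using s_subset[of "Suc l"] S unfolding True
      by (intro member_le_sum) (auto intro!: gap_nonneg finite_subset[OF _ finite_atLeastAtMost])
    then show ?thesis using True by simp
  next
    case False
    then show ?thesis
      using s_subset[of "Suc l"] by (auto intro!: sum_nonneg gap_nonneg)
  qed
  then have "(\<Sum>l<N. gap i l * indicator {l. s (Suc l) = S} l) \<le> (\<Sum>l<N. \<Sum>i\<in>s (Suc l). gap i l)"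
    by (intro sum_mono)
  also have "\<dots> = real n * (\<Sum>l<N. (\<Sum>i\<in>s (Suc l). gap i l) / real n)"
    using n_pos by (simp add: sum_divide_distrib[symmetric])
  also have "\<dots> \<le> real n * (model_value 0 - \<alpha>)"
    by (intro mult_left_mono sum_sampled_gaps_le) simp
  finally show ?thesis .
qed

text \<open>
  The consequences of summable gaps; this hypothesis is what sampling yields almost surely.
\<close>

context
  assumes summable_gap: "\<And>i. i \<in> {1..n} \<Longrightarrow> summable (gap i)"
begin

lemma summable_mean_gap: "summable mean_gap"
  unfolding mean_gap_def by (intro summable_divide summable_sum summable_gap) 

text \<open>
  The objective at \<open>x (Suc l)\<close> is \<open>model_value l - mean_gap l\<close>, a decreasing sequence that is bounded
  below minus a null sequence.
\<close>

lemma objective_convergent: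
  "\<exists>L. (\<lambda>l. G (x l) - ereal (H (x l))) \<longlonglongrightarrow> ereal L"
proof -
  have "decseq model_value"
  proof (rule decseq_SucI)
    fix l
    have "0 \<le> (\<Sum>i\<in>s (Suc l). gap i l) / real n"
      using s_subset[of "Suc l"] by (auto intro!: divide_nonneg_nonneg sum_nonneg gap_nonneg)
    then show "model_value (Suc l) \<le> model_value l"
      using model_value_Suc[of l] by linarith
  qed
  then obtain L where L: "model_value \<longlonglongrightarrow> L"
    using model_value_ge by (metis decseq_convergent)
  have "(\<lambda>l. model_value l - mean_gap l) \<longlonglongrightarrow> L - 0"
    by (intro tendsto_diff L summable_LIMSEQ_zero summable_mean_gap)
  moreover have "G (x (Suc l)) - ereal (H (x (Suc l))) = ereal (model_value l - mean_gap l)" for l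
    by (subst G_finite) (simp add: model_value_eq)
  ultimately have "(\<lambda>l. G (x (Suc l)) - ereal (H (x (Suc l)))) \<longlonglongrightarrow> ereal L"
    by simp
  then show ?thesis
    using LIMSEQ_imp_Suc[of "\<lambda>l. G (x l) - ereal (H (x l))"] by blast
qed

text \<open>
  Some index is drawn at every step, and its cut is centred at the current iterate, so strong
  convexity makes its gap at the next iterate control the squared step.
\<close>

lemma summable_steps:
  assumes \<rho>: "\<rho> > 0"
    and conv: "\<And>i. i \<in> {1..n} \<Longrightarrow> \<exists>r\<ge>\<rho>. convex_fun (\<lambda>y. ereal (h i y) - ereal (r / 2 * (norm y)\<^sup>2))"
  shows "summable (\<lambda>l. (norm (x (Suc l) - x l))\<^sup>2)"
proof (rule summable_comparison_test')
  show "summable (\<lambda>l. 2 / \<rho> * (\<Sum>i\<in>{1..n}. gap i l))"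
    by (intro summable_mult summable_sum summable_gap)
  fix l
  obtain i where i: "i \<in> s l"
    using s_nonempty by blast
  then have i': "i \<in> {1..n}"
    using s_subset by blast
  obtain r where r: "r \<ge> \<rho>" "convex_fun (\<lambda>y. ereal (h i y) - ereal (r / 2 * (norm y)\<^sup>2))"
    using conv[OF i'] by blast
  have "\<rho> / 2 * (norm (x (Suc l) - x l))\<^sup>2 \<le> r / 2 * (norm (x (Suc l) - x l))\<^sup>2"
    using r(1) by (intro mult_right_mono) auto
  also have "\<dots> \<le> gap i l"
    unfolding gap_def using i fresh[OF i] by (intro cut_gap_ge_dist r(2)) auto
  also have "\<dots> \<le> (\<Sum>i\<in>{1..n}. gap i l)"
    using i' by (intro member_le_sum) (auto intro: gap_nonneg)
  finally show "norm ((norm (x (Suc l) - x l))\<^sup>2) \<le> 2 / \<rho> * (\<Sum>i\<in>{1..n}. gap i l)"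
    using \<rho> by (simp add: field_simps)
qed

lemma limit_point_critical:
  assumes cont: "continuous_on UNIV H"
    and lsc: "\<And>X a. X \<longlonglongrightarrow> a \<Longrightarrow> G a \<le> liminf (\<lambda>k. G (X k))"
    and r: "strict_mono r" and lim: "(\<lambda>k. x (r k)) \<longlonglongrightarrow> a"
  shows "critical_point G H a"
proof -
  \<comment> \<open>The approximate optimality conditions concern iterates of positive index, and \<open>r 0\<close> may be
    0; hence the shift.\<close>
  define q where "q k = r (Suc k) - 1" for k
  have rq: "r (Suc k) = Suc (q k)" for k
    using strict_monoD[OF r, of 0 "Suc k"] by (simp add: q_def)
  have "strict_mono q"
    using r unfolding strict_mono_Suc_iff by (metis Suc_less_eq rq)
  then have \<epsilon>: "(\<lambda>k. mean_gap (q k)) \<longlonglongrightarrow> 0"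
    using LIMSEQ_subseq_LIMSEQ[OF summable_LIMSEQ_zero[OF summable_mean_gap]]
    by (simp add: o_def)
  have X: "(\<lambda>k. x (Suc (q k))) \<longlonglongrightarrow> a"
    using LIMSEQ_Suc[OF lim] by (simp add: rq)
  show ?thesis
  proof (rule critical_point_limit[OF cont lsc[OF X] _ X \<epsilon>])
    show "G a \<noteq> -\<infinity>"
      using proper by (simp add: proper_fun_def)
    show "H (x (Suc (q k))) + mean_v (q k) \<bullet> (y - x (Suc (q k))) \<le> H y + mean_gap (q k)" for k y
      by (rule mean_v_approx_subgradient)
    show "mean_v (q k) \<in> subdifferential G (x (Suc (q k)))" for k
      using optimal by (simp add: mean_v_def)
  qed
qed

end

end

section \<open>Measurability with respect to the history\<close>

lemma space_sdca_history [simp]: "space (sdca_history M n x s v l) = space M"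
  by (simp add: sdca_history_def space_measure_of_conv)

lemma sets_sdca_history:
  "sets (sdca_history M n x s v l) = sigma_sets (space M)
     ({x k -` A \<inter> space M | k A. k \<le> l \<and> A \<in> sets borel} \<union>
      {s k -` A \<inter> space M | k A. k < l} \<union>
      {v k i -` A \<inter> space M | k i A. k < l \<and> i \<in> {1..n} \<and> A \<in> sets borel})"
  unfolding sdca_history_def by (rule sets_measure_of) auto

lemma sdca_history_measurable:
  shows x_measurable_history: "k \<le> l \<Longrightarrow> x k \<in> borel_measurable (sdca_history M n x s v l)"
    and v_measurable_history:
      "k < l \<Longrightarrow> i \<in> {1..n} \<Longrightarrow> v k i \<in> borel_measurable (sdca_history M n x s v l)"
    and s_measurable_history:
      "k < l \<Longrightarrow> s k \<in> measurable (sdca_history M n x s v l) (count_space UNIV)"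
  by (rule measurableI; force simp: sets_sdca_history intro!: sigma_sets.Basic)+

lemma subalgebra_sdca_history:
  assumes "\<And>k. x k \<in> borel_measurable M"
    and "\<And>k. s k \<in> measurable M (count_space (Pow {1..n}))"
    and "\<And>k i. i \<in> {1..n} \<Longrightarrow> v k i \<in> borel_measurable M"
  shows "subalgebra M (sdca_history M n x s v l)"
proof -
  have "s k -` A \<inter> space M \<in> sets M" for k A
  proof -
    have "s k -` A \<inter> space M = s k -` (A \<inter> Pow {1..n}) \<inter> space M"
      using measurable_space[OF assms(2)] by fastforce
    also have "\<dots> \<in> sets M"
      by (rule measurable_sets[OF assms(2)]) simp
    finally show ?thesis .
  qed
  then show ?thesis
    unfolding subalgebra_def sets_sdca_history
    by (intro conjI sets.sigma_sets_subset)
      (auto intro: measurable_sets[OF assms(1)] measurable_sets[OF assms(3)])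
qed

lemma cut_offset_measurable:
  assumes f: "f \<in> borel_measurable borel"
    and x: "\<And>k. k \<le> l \<Longrightarrow> x k \<in> borel_measurable N"
    and u: "\<And>k. k \<le> l \<Longrightarrow> u k \<in> borel_measurable N"
    and fresh: "\<And>k. k \<le> l \<Longrightarrow> Measurable.pred N (\<lambda>\<omega>. fresh k \<omega>)"
  shows "(\<lambda>\<omega>. cut_offset f (\<lambda>k. x k \<omega> :: 'a::euclidean_space) (\<lambda>k. fresh k \<omega>) (\<lambda>k. u k \<omega>) l)
    \<in> borel_measurable N"
  using x u fresh
proof (induction l)
  case 0
  note [measurable] = 0(1)[of 0] 0(2)[of 0] f
  show ?case
    using 0 by simp
next
  case (Suc l)
  note [measurable] = Suc(2)[of "Suc l"] Suc(3)[of "Suc l"] Suc(4)[of "Suc l"] Suc(1) f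
  show ?case
    using Suc by simp
qed

text \<open>
  The gap at \<open>x (Suc l)\<close> uses the cuts of step \<open>l\<close>, hence only the draws up to \<open>s l\<close>; it belongs to
  the history before \<open>s (Suc l)\<close> is drawn.
\<close>

lemma cut_gap_measurable_history:
  fixes x :: "nat \<Rightarrow> 'w \<Rightarrow> 'a::euclidean_space"
  assumes f: "f \<in> borel_measurable borel" and i: "i \<in> {1..n}"
  shows "(\<lambda>\<omega>. cut_gap f (\<lambda>k. x k \<omega>) (\<lambda>k. i \<in> s k \<omega>) (\<lambda>k. v k i \<omega>) l)
    \<in> borel_measurable (sdca_history M n x s v (Suc l))"
proof -
  let ?N = "sdca_history M n x s v (Suc l)"
  have pred: "Measurable.pred ?N (\<lambda>\<omega>. i \<in> s k \<omega>)" if "k \<le> l" for k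
  proof -
    have "s k \<in> measurable ?N (count_space UNIV)"
      using that by (intro s_measurable_history) simp
    from measurable_compose[OF this, of "\<lambda>S. i \<in> S" "count_space UNIV"] show ?thesis
      by simp
  qed
  note [measurable] = f x_measurable_history[of "Suc l" "Suc l"] v_measurable_history[of l "Suc l", OF _ i]
  have [measurable]: "(\<lambda>\<omega>. cut_offset f (\<lambda>k. x k \<omega>) (\<lambda>k. i \<in> s k \<omega>) (\<lambda>k. v k i \<omega>) l) \<in> borel_measurable ?N"
    by (intro cut_offset_measurable f pred x_measurable_history v_measurable_history i) auto
  show ?thesis
    unfolding cut_gap_def by measurable
qed

section \<open>Convergence of SDCA\<close>

lemma sdca_sequenceD:
  assumes "sdca_sequence M n b G h x s v"
  shows sdca_x_measurable: "\<And>l. x l \<in> borel_measurable M"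
    and sdca_s_measurable: "\<And>l. s l \<in> measurable M (count_space (Pow {1..n}))"
    and sdca_v_measurable: "\<And>l i. i \<in> {1..n} \<Longrightarrow> v l i \<in> borel_measurable M"
    and sdca_x_zero: "\<exists>x0. \<forall>\<omega>\<in>space M. x 0 \<omega> = x0"
    and sdca_s_zero: "\<And>\<omega>. \<omega> \<in> space M \<Longrightarrow> s 0 \<omega> = {1..n}"
    and sdca_fresh: "\<And>\<omega> l i. \<omega> \<in> space M \<Longrightarrow> i \<in> s l \<omega> \<Longrightarrow>
      v l i \<omega> \<in> subdifferential (\<lambda>y. ereal (h i y)) (x l \<omega>)"
    and sdca_stale: "\<And>\<omega> l i. \<omega> \<in> space M \<Longrightarrow> l > 0 \<Longrightarrow> i \<in> {1..n} - s l \<omega> \<Longrightarrow>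
      v l i \<omega> = v (l - 1) i \<omega>"
    and sdca_arg_min: "\<And>\<omega> l. \<omega> \<in> space M \<Longrightarrow>
      is_arg_min (\<lambda>y. G y - ereal (((1 / real n) *\<^sub>R (\<Sum>i\<in>{1..n}. v l i \<omega>)) \<bullet> y)) (\<lambda>_. True)
        (x (Suc l) \<omega>)"
    and sdca_card: "\<And>\<omega> l. \<omega> \<in> space M \<Longrightarrow> l > 0 \<Longrightarrow> card (s l \<omega>) = b"
    and sdca_uniform: "\<And>l S. l > 0 \<Longrightarrow> S \<subseteq> {1..n} \<Longrightarrow> card S = b \<Longrightarrow>
      AE \<omega> in M. real_cond_exp M (sdca_history M n x s v l)
        (indicator {\<omega>\<in>space M. s l \<omega> = S}) \<omega> = 1 / real (n choose b)"
proof -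
  note c = assms[unfolded sdca_sequence_def]
  note c1 = conjunct2[OF c] note c2 = conjunct2[OF c1] note c3 = conjunct2[OF c2]
  note c4 = conjunct2[OF c3] note c5 = conjunct2[OF c4] note c6 = conjunct2[OF c5]
  note c7 = conjunct2[OF c6] note c8 = conjunct2[OF c7] note c9 = conjunct2[OF c8]
  show "\<And>l. x l \<in> borel_measurable M" using conjunct1[OF c] by blast
  show "\<And>l. s l \<in> measurable M (count_space (Pow {1..n}))" using conjunct1[OF c1] by blast
  show "\<And>l i. i \<in> {1..n} \<Longrightarrow> v l i \<in> borel_measurable M" using conjunct1[OF c2] by blast
  show "\<exists>x0. \<forall>\<omega>\<in>space M. x 0 \<omega> = x0" by (rule conjunct1[OF c3])
  show "\<And>\<omega>. \<omega> \<in> space M \<Longrightarrow> s 0 \<omega> = {1..n}" using conjunct1[OF c4] by blast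
  show "\<And>\<omega> l i. \<omega> \<in> space M \<Longrightarrow> i \<in> s l \<omega> \<Longrightarrow>
      v l i \<omega> \<in> subdifferential (\<lambda>y. ereal (h i y)) (x l \<omega>)" using conjunct1[OF c5] by blast
  show "\<And>\<omega> l i. \<omega> \<in> space M \<Longrightarrow> l > 0 \<Longrightarrow> i \<in> {1..n} - s l \<omega> \<Longrightarrow>
      v l i \<omega> = v (l - 1) i \<omega>" using conjunct1[OF c6] by blast
  show "\<And>\<omega> l. \<omega> \<in> space M \<Longrightarrow>
      is_arg_min (\<lambda>y. G y - ereal (((1 / real n) *\<^sub>R (\<Sum>i\<in>{1..n}. v l i \<omega>)) \<bullet> y)) (\<lambda>_. True)
        (x (Suc l) \<omega>)" using conjunct1[OF c7] by blast
  show "\<And>\<omega> l. \<omega> \<in> space M \<Longrightarrow> l > 0 \<Longrightarrow> card (s l \<omega>) = b" using conjunct1[OF c8] by blast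
  show "\<And>l S. l > 0 \<Longrightarrow> S \<subseteq> {1..n} \<Longrightarrow> card S = b \<Longrightarrow>
      AE \<omega> in M. real_cond_exp M (sdca_history M n x s v l)
        (indicator {\<omega>\<in>space M. s l \<omega> = S}) \<omega> = 1 / real (n choose b)" using c9 by blast
qed

lemma sdca_path_of_sequence:
  assumes seq: "sdca_sequence M n b G h x s v"
    and \<omega>: "\<omega> \<in> space M"
    and n: "n \<ge> 1" and b: "b \<ge> 1"
    and proper: "proper_fun G"
    and lower: "\<And>y. ereal (\<alpha> + (\<Sum>i\<in>{1..n}. h i y) / real n) \<le> G y"
  shows "sdca_path n h G \<alpha> (\<lambda>l. x l \<omega>) (\<lambda>l. s l \<omega>) (\<lambda>l i. v l i \<omega>)"
proof
  show "s 0 \<omega> = {1..n}"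
    by (rule sdca_s_zero[OF seq \<omega>])
  show "s l \<omega> \<subseteq> {1..n}" for l
    using measurable_space[OF sdca_s_measurable[OF seq] \<omega>, of l] by simp
  show "s l \<omega> \<noteq> {}" for l
    using sdca_s_zero[OF seq \<omega>] sdca_card[OF seq \<omega>, of l] n b by (cases "l = 0") auto
  show "v l i \<omega> \<in> subdifferential (\<lambda>y. ereal (h i y)) (x l \<omega>)" if "i \<in> s l \<omega>" for l i
    by (rule sdca_fresh[OF seq \<omega> that])
  show "v (Suc l) i \<omega> = v l i \<omega>" if "i \<in> {1..n} - s (Suc l) \<omega>" for l i
    using sdca_stale[OF seq \<omega> _ that] by simp
  show "(1 / real n) *\<^sub>R (\<Sum>i\<in>{1..n}. v l i \<omega>) \<in> subdifferential G (x (Suc l) \<omega>)" for l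
    by (rule subdifferential_if_arg_min[OF sdca_arg_min[OF seq \<omega>]])
qed (rule n proper lower)+

theorem theorem1:
  fixes M :: "'w measure"
    and n b :: nat
    and g :: "nat \<Rightarrow> real ^ 'd \<Rightarrow> ereal"
    and h :: "nat \<Rightarrow> real ^ 'd \<Rightarrow> real"
    and G F :: "real ^ 'd \<Rightarrow> ereal"
    and H :: "real ^ 'd \<Rightarrow> real"
    and x :: "nat \<Rightarrow> 'w \<Rightarrow> real ^ 'd"
    and s :: "nat \<Rightarrow> 'w \<Rightarrow> nat set"
    and v :: "nat \<Rightarrow> nat \<Rightarrow> 'w \<Rightarrow> real ^ 'd"
  assumes "prob_space M"
    and "n \<ge> 1"
    and "b \<in> {1..n}"
    and "\<And>i. i \<in> {1..n} \<Longrightarrow> lsc_fun (g i) \<and> proper_fun (g i) \<and> convex_fun (g i)"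
    and "\<And>i. i \<in> {1..n} \<Longrightarrow> convex_on UNIV (h i)"
    and "G = (\<lambda>y. (\<Sum>i\<in>{1..n}. g i y) / ereal (real n))"
    and "H = (\<lambda>y. (\<Sum>i\<in>{1..n}. h i y) / real n)"
    and "F = (\<lambda>y. (\<Sum>i\<in>{1..n}. g i y - ereal (h i y)) / ereal (real n))"
    and "proper_fun G"
    and "(INF y. F y) > -\<infinity>"
    and "sdca_sequence M n b G h x s v"
  shows "(AE \<omega> in M. \<exists>L::real. (\<lambda>l. F (x l \<omega>)) \<longlonglongrightarrow> ereal L)
    \<and> (Min ((\<lambda>i. convexity_modulus (\<lambda>y. ereal (h i y))) ` {1..n}) > 0 \<longrightarrow>
        (AE \<omega> in M. summable (\<lambda>l. (norm (x (Suc l) \<omega> - x l \<omega>))\<^sup>2)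
                  \<and> (\<lambda>l. norm (x (Suc l) \<omega> - x l \<omega>)) \<longlonglongrightarrow> 0))
    \<and> (Min ((\<lambda>i. convexity_modulus (\<lambda>y. ereal (h i y))) ` {1..n}) > 0 \<longrightarrow>
        (AE \<omega> in M. \<forall>xs r. strict_mono r \<and> (\<lambda>k. x (r k) \<omega>) \<longlonglongrightarrow> xs \<longrightarrow> critical_point G H xs))"
proof -
  note n = assms(2) and b = assms(3) and g = assms(4) and G_def = assms(6) and H_def = assms(7)
    and F_def = assms(8) and proper = assms(9)
  note seq = assms(11)
  obtain x0 where x0: "\<And>\<omega>. \<omega> \<in> space M \<Longrightarrow> x 0 \<omega> = x0"
    using sdca_x_zero[OF seq] by blast
  have hcont: "continuous_on UNIV (h i)" if "i \<in> {1..n}" for i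
    by (intro convex_on_continuous assms(5) that) simp
  have Hcont: "continuous_on UNIV H"
    unfolding H_def using n by (intro continuous_intros hcont) auto
  have F_eq: "F y = G y - ereal (H y)" for y
    unfolding F_def G_def H_def sum_minus_ereal
    using n by (cases "\<Sum>i\<in>{1..n}. g i y") (auto simp: diff_divide_distrib)
  obtain \<alpha> where "ereal \<alpha> < (INF y. F y)"
    using ereal_dense2[OF assms(10)] by blast
  then have \<alpha>: "ereal \<alpha> \<le> F y" for y
    by (meson INF_lower UNIV_I less_imp_le order_trans)
  have lower: "ereal (\<alpha> + (\<Sum>i\<in>{1..n}. h i y) / real n) \<le> G y" for y
    using \<alpha>[of y] unfolding F_eq by (cases "G y") (auto simp: H_def)
  have path: "sdca_path n h G \<alpha> (\<lambda>l. x l \<omega>) (\<lambda>l. s l \<omega>) (\<lambda>l i. v l i \<omega>)"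
    if "\<omega> \<in> space M" for \<omega>
    using b by (intro sdca_path_of_sequence[OF seq that n _ proper lower]) simp
  obtain \<omega>0 where "\<omega>0 \<in> space M"
    using prob_space.not_empty[OF assms(1)] by blast
  then have H_path: "sdca_path.H n h = H"
    unfolding H_def by (intro ext sdca_path.H_def[OF path])

  \<comment> \<open>A constant that bounds the sampled gaps along all trajectories at once: it rests on the common
    initial point, a finite value of \<open>G\<close> and a bound for \<open>H\<close> near the initial point.\<close>
  obtain y0 r0 where y0: "G y0 = ereal r0"
    using proper unfolding proper_fun_def by (metis ereal_cases)
  have "compact (H ` cball x0 1)"
    by (intro compact_continuous_image continuous_on_subset[OF Hcont]) auto
  then obtain B where "\<forall>z\<in>H ` cball x0 1. norm z \<le> B"
    using compact_imp_bounded bounded_iff by metis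
  then have B: "H z \<le> B" if "z \<in> cball x0 1" for z
    using that by force
  define C where "C = real n * (r0 - H x0 + (B - H x0) * norm (x0 - y0) - \<alpha>)"
  define e where "e i l \<omega> = cut_gap (h i) (\<lambda>k. x k \<omega>) (\<lambda>k. i \<in> s k \<omega>) (\<lambda>k. v k i \<omega>) l" for i l \<omega>

  have summable_e: "AE \<omega> in M. summable (\<lambda>l. e i l \<omega>)" if i: "i \<in> {1..n}" for i
  proof -
    \<comment> \<open>Any admissible sample that contains \<open>i\<close> serves.\<close>
    obtain S where S: "i \<in> S" "S \<subseteq> {1..n}" "card S = b"
    proof -
      obtain T where "{i} \<subseteq> T" "T \<subseteq> {1..n}" "card T = b"
        using exists_subset_between[of "{i}" b "{1..n}"] i b by auto
      then show thesis using that[of T] by auto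
    qed
    let ?F = "\<lambda>l. sdca_history M n x s v (Suc l)"
    let ?B = "\<lambda>l. {\<omega> \<in> space M. s (Suc l) \<omega> = S}"
    have "AE \<omega> in M. real_cond_exp M (?F l) (indicator (?B l)) \<omega> = 1 / real (n choose b)" for l
      by (rule sdca_uniform[OF seq _ S(2,3)]) simp
    moreover have "1 / real (n choose b) > 0"
      using b by (simp add: zero_less_binomial)
    moreover have "?B l \<in> sets M" for l
    proof -
      have "?B l = s (Suc l) -` {S} \<inter> space M" by auto
      then show ?thesis using measurable_sets[OF sdca_s_measurable[OF seq], of "{S}"] S(2) by simp
    qed
    moreover have "e i l \<in> borel_measurable (?F l)" for l
      unfolding e_def using i
      by (intro cut_gap_measurable_history borel_measurable_continuous_onI hcont)
    moreover have "0 \<le> e i l \<omega>" if "\<omega> \<in> space M" for l \<omega>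
      using sdca_path.gap_nonneg[OF path[OF that] i] sdca_path.gap_def[OF path[OF that]]
      by (simp add: e_def)
    moreover have "(\<Sum>l<N. e i l \<omega> * indicator (?B l) \<omega>) \<le> C" if \<omega>: "\<omega> \<in> space M" for N \<omega>
    proof -
      interpret sdca_path n h G \<alpha> "\<lambda>l. x l \<omega>" "\<lambda>l. s l \<omega>" "\<lambda>l i. v l i \<omega>"
        by (rule path[OF \<omega>])
      have "(\<Sum>l<N. e i l \<omega> * indicator (?B l) \<omega>)
          = (\<Sum>l<N. gap i l * indicator {l. s (Suc l) \<omega> = S} l)"
        using \<omega> by (simp add: e_def gap_def indicator_def)
      also have "\<dots> \<le> real n * (model_value 0 - \<alpha>)"
        by (rule sum_gap_le[OF i S(1)])
      also have "\<dots> \<le> C"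
        using model_value_0_le[OF y0, of B] B unfolding C_def H_path x0[OF \<omega>]
        by (intro mult_left_mono diff_right_mono) auto
      finally show ?thesis .
    qed
    ultimately show ?thesis
      by (intro summable_of_sampled[OF assms(1) subalgebra_sdca_history[OF sdca_sequenceD(1-3)[OF seq]]])
  qed
  have "AE \<omega> in M. \<forall>i\<in>{1..n}. summable (\<lambda>l. e i l \<omega>)"
    by (intro AE_finite_allI summable_e) auto
  with AE_space have good: "AE \<omega> in M. \<omega> \<in> space M \<and> (\<forall>i\<in>{1..n}. summable (\<lambda>l. e i l \<omega>))"
    by (rule AE_conjI)
  have summable_gap: "summable (sdca_path.gap h (\<lambda>l. x l \<omega>) (\<lambda>l. s l \<omega>) (\<lambda>l i. v l i \<omega>) i)"
    if "\<omega> \<in> space M \<and> (\<forall>i\<in>{1..n}. summable (\<lambda>l. e i l \<omega>))" "i \<in> {1..n}" for \<omega> i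
    using that by (simp add: e_def sdca_path.gap_def[OF path])

  show ?thesis
  proof (intro conjI impI)
    show "AE \<omega> in M. \<exists>L::real. (\<lambda>l. F (x l \<omega>)) \<longlonglongrightarrow> ereal L"
      using good
    proof eventually_elim
      case (elim \<omega>)
      then show ?case
        using sdca_path.objective_convergent[OF path summable_gap[OF elim]]
        unfolding H_path F_eq by simp
    qed
  next
    assume "Min ((\<lambda>i. convexity_modulus (\<lambda>y. ereal (h i y))) ` {1..n}) > 0"
    then obtain \<rho> where \<rho>: "\<rho> > 0"
      "\<And>i. i \<in> {1..n} \<Longrightarrow> \<exists>r\<ge>\<rho>. convex_fun (\<lambda>y. ereal (h i y) - ereal (r / 2 * (norm y)\<^sup>2))"
      using uniform_modulus[of "{1..n}" "\<lambda>i y. ereal (h i y)"] n by auto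
    show "AE \<omega> in M. summable (\<lambda>l. (norm (x (Suc l) \<omega> - x l \<omega>))\<^sup>2)
        \<and> (\<lambda>l. norm (x (Suc l) \<omega> - x l \<omega>)) \<longlonglongrightarrow> 0"
      using good
    proof eventually_elim
      case (elim \<omega>)
      then have sum: "summable (\<lambda>l. (norm (x (Suc l) \<omega> - x l \<omega>))\<^sup>2)"
        using sdca_path.summable_steps[OF path summable_gap[OF elim] \<rho>] by simp
      have "(\<lambda>l. sqrt ((norm (x (Suc l) \<omega> - x l \<omega>))\<^sup>2)) \<longlonglongrightarrow> sqrt 0"
        by (intro tendsto_real_sqrt summable_LIMSEQ_zero sum)
      then show ?case
        using sum by simp
    qed
  next
    show "AE \<omega> in M. \<forall>xs r. strict_mono r \<and> (\<lambda>k. x (r k) \<omega>) \<longlonglongrightarrow> xs \<longrightarrow> critical_point G H xs"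
      using good
    proof eventually_elim
      case (elim \<omega>)
      have "G a \<le> liminf (\<lambda>k. G (X k))" if "X \<longlonglongrightarrow> a" for X a
        unfolding G_def using n g that by (intro lsc_mean) auto
      then show ?case
        using sdca_path.limit_point_critical[OF path summable_gap[OF elim]] elim Hcont
        unfolding H_path by blast
    qed
  qed
qed

end
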